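(* For every integer $n>0$, $$\mathfrak B_{2n}+\sum_{\substack{p\ \text{odd prime}\\ (p-1)\mid 2n}}\frac{(-1)^{\,n-\frac{p-1}{2}}}{p}$$ is an integer, where the sum runs over all odd primes $p$ such that $p-1$ divides $2n$.
   Context: The Bernoulli numbers with level $2$, $\mathfrak B_n$, are defined by the power series identity $$\frac{1}{4\sin(x/2)}\log\frac{1+2\sin(x/2)}{1-2\sin(x/2)}=\sum_{n=0}^\infty\mathfrak B_n\frac{x^n}{n!}.$$ Equivalently $\sum_{n\ge0}\mathfrak B_n\frac{x^n}{n!}=\sum_{m\ge0}\frac{(2\sin(x/2))^{2m}}{2m+1}$. *)

theory Defs
  imports "HOL-Computational_Algebra.Computational_Algebra"
begin

definition two_sin_half :: "rat fps" where
  "two_sin_half = 2 * fps_sin (1/2)"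

text \<open>
  The series of \<open>log ((1 + s) / (1 - s))\<close> with \<open>s = 2 sin (x/2)\<close>. The series \<open>fps_ln 1\<close> is that of
  \<open>log (1 + X)\<close>, so the argument substituted for \<open>X\<close> is \<open>(1 + s) / (1 - s) - 1\<close>,
  which has vanishing constant term.
\<close>

definition log_ratio_fps :: "rat fps" where
  "log_ratio_fps = fps_ln 1 oo ((1 + two_sin_half) / (1 - two_sin_half) - 1)"

text \<open>
  The denominator \<open>4 sin (x/2)\<close> is a nonzero series of subdegree 1 and the numerator
  has zero constant term, so this division of power series is exact.
\<close>

definition bernoulli_level2_fps :: "rat fps" where
  "bernoulli_level2_fps = log_ratio_fps / (2 * two_sin_half)"

definition bernoulli_level2 :: "nat \<Rightarrow> rat" where
  "bernoulli_level2 n = fact n * fps_nth bernoulli_level2_fps n"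

end

(* Differentiating (2 sin(x/2))^(2m) twice shows that its 2n-th Taylor coefficient, times (2n)!, is
   (-1)^(m+n) (2m)! T(2n,2m) with integral central factorial numbers T.  Hence B_(2n) is the sum of
   (-1)^(m+n) (2m)! T(2n,2m) / (2m+1) over m <= n.  If 2m+1 is composite, it divides (2m)!.
   If 2m+1 = p is prime, then (2m)! T(2n,2m) is the 2m-th central difference of x^(2n) at 0; by
   Fermat's theorem it depends modulo p only on n mod m, so n may be replaced by a representative
   in {1..m}: for n < m the difference vanishes, and for n = m it is (p-1)!, which is -1 by Wilson. *)

theory Submission
  imports Defs "HOL-Number_Theory.Residues"
begin

section \<open>The generating function as a series in 2 sin(x/2)\<close>

text \<open>The even series artanh(X)/X, so that only even powers of 2 sin(x/2) will need
  expanding.\<close>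

definition artanh_quot_fps :: "rat fps" where
  "artanh_quot_fps = Abs_fps (\<lambda>k. if even k then 1 / of_nat (Suc k) else 0)"

lemma fps_deriv_X_artanh_quot:
  "fps_deriv (fps_X * artanh_quot_fps) * (1 - fps_X ^ 2) = 1"
proof -
  have "fps_X * artanh_quot_fps = Abs_fps (\<lambda>k. if odd k then 1 / of_nat k else 0)"
    by (rule fps_ext) (auto simp: artanh_quot_fps_def)
  hence 1: "fps_deriv (fps_X * artanh_quot_fps) = Abs_fps (\<lambda>k. if even k then 1 else 0)"
    by (simp only:) (rule fps_ext, simp del: of_nat_Suc)
  show ?thesis
    unfolding 1
    by (rule fps_ext)
      (auto simp: right_diff_distrib fps_X_power_mult_right_nth)
qed

text \<open>This is log((1+s)/(1-s)) = 2 artanh s: both sides have constant term 0 and derivative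
  2s'/(1-s^2).\<close>

lemma fps_ln_ratio:
  fixes s :: "rat fps"
  assumes s0: "fps_nth s 0 = 0"
  shows "fps_ln 1 oo ((1 + s) / (1 - s) - 1) = 2 * s * (artanh_quot_fps oo s)"
proof -
  define q where "q = (1 + s) / (1 - s)"
  define L where "L = fps_ln 1 oo (q - 1)"
  define F where "F = fps_X * artanh_quot_fps"
  have nz: "1 - s \<noteq> 0" "1 + s \<noteq> 0" "fps_nth (1 - s) 0 \<noteq> 0"
    using s0 by (auto dest: arg_cong[of _ _ "\<lambda>f. fps_nth f 0"])
  have qs: "q * (1 - s) = 1 + s"
    unfolding q_def using nz s0 by (intro fps_times_divide_eq) auto
  have q0: "fps_nth q 0 = 1"
    using arg_cong[OF qs, of "\<lambda>f. fps_nth f 0"] s0 by simp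
  have "fps_deriv L = (inverse (1 + fps_X) oo (q - 1)) * fps_deriv q"
    unfolding L_def by (subst fps_compose_deriv) (use q0 in \<open>auto simp: fps_ln_deriv\<close>)
  also have "inverse (1 + fps_X) oo (q - 1) = inverse q"
    by (subst fps_inverse_compose) (use q0 in \<open>auto simp: fps_compose_add_distrib\<close>)
  finally have L': "fps_deriv L * q = fps_deriv q"
    using q0 by (simp add: mult.commute mult.left_commute inverse_mult_eq_1')
  have q': "fps_deriv q * (1 - s) - q * fps_deriv s = fps_deriv s"
    using arg_cong[OF qs, of fps_deriv] by (simp add: algebra_simps)
  \<comment> \<open>Factor \<open>1 - s^2\<close> as (1+s)(1-s) and write 1+s as
    \<open>q * (1 - s)\<close>, so that \<open>L'\<close> can turn L' q into q'.\<close>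
  have "fps_deriv L * (1 - s^2) * 1 = fps_deriv L * (q * (1 - s)) * (1 - s)"
    unfolding qs by (simp add: algebra_simps power2_eq_square)
  also have "\<dots> = (fps_deriv q * (1 - s)) * (1 - s)"
    unfolding L'[symmetric] by (simp only: mult_ac)
  also have "fps_deriv q * (1 - s) = fps_deriv s + q * fps_deriv s"
    using q' by (simp add: algebra_simps)
  also have "\<dots> * (1 - s) = fps_deriv s * (1 - s) + fps_deriv s * (q * (1 - s))"
    by (simp add: algebra_simps)
  also have "\<dots> = 2 * fps_deriv s"
    unfolding qs by (simp add: algebra_simps)
  finally have 1: "fps_deriv L * (1 - s^2) = 2 * fps_deriv s" by simp
  have "(fps_deriv F * (1 - fps_X ^ 2)) oo s = 1"
    unfolding F_def fps_deriv_X_artanh_quot by simp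
  hence 2: "(fps_deriv F oo s) * (1 - s^2) = 1"
    using s0 by (simp add: fps_compose_mult_distrib fps_compose_sub_distrib fps_compose_power[symmetric])
  have "fps_deriv (2 * (F oo s)) * (1 - s^2) = 2 * fps_deriv s * ((fps_deriv F oo s) * (1 - s^2))"
    using fps_compose_deriv[OF s0, of F] by (simp add: algebra_simps)
  also have "\<dots> = fps_deriv L * (1 - s^2)"
    unfolding 1 2 by simp
  finally have "fps_deriv (2 * (F oo s)) * (1 - s^2) = fps_deriv L * (1 - s^2)" .
  moreover have "1 - s^2 \<noteq> 0"
    using 2 by (metis mult_zero_right zero_neq_one)
  ultimately have "fps_deriv L = fps_deriv (2 * (F oo s))"
    by (metis mult_right_cancel)
  moreover have "fps_nth L 0 = 0" "fps_nth (2 * (F oo s)) 0 = 0"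
    by (simp_all add: L_def F_def numeral_fps_const)
  ultimately have "L = 2 * (F oo s)"
    by (subst (asm) fps_deriv_eq_iff) simp
  also have "F oo s = s * (artanh_quot_fps oo s)"
    using s0 by (simp add: F_def fps_compose_mult_distrib)
  finally show ?thesis by (simp add: L_def q_def mult.assoc)
qed

lemma two_sin_half_nth_0 [simp]: "fps_nth two_sin_half 0 = 0"
  by (simp add: two_sin_half_def)

lemma two_sin_half_nonzero: "two_sin_half \<noteq> 0"
proof -
  have "fps_nth two_sin_half 1 = 1"
    by (simp add: two_sin_half_def numeral_fps_const fps_sin_def)
  thus ?thesis by auto
qed

lemma bernoulli_level2_fps_eq: "bernoulli_level2_fps = artanh_quot_fps oo two_sin_half"
proof -
  have "log_ratio_fps = (artanh_quot_fps oo two_sin_half) * (2 * two_sin_half)"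
    unfolding log_ratio_fps_def by (subst fps_ln_ratio) (simp_all add: mult_ac)
  thus ?thesis
    unfolding bernoulli_level2_fps_def
    using two_sin_half_nonzero
    by (metis fps_divide_times_eq mult_eq_0_iff zero_neq_numeral)
qed

section \<open>Taylor coefficients of even powers of 2 sin(x/2)\<close>

text \<open>\<open>central_factorial m n\<close> is the number usually written \<open>T(2n, 2m)\<close>.\<close>

fun central_factorial :: "nat \<Rightarrow> nat \<Rightarrow> nat" where
  "central_factorial 0 0 = 1"
| "central_factorial 0 (Suc n) = 0"
| "central_factorial (Suc m) 0 = 0"
| "central_factorial (Suc m) (Suc n) =
     central_factorial m n + (Suc m)\<^sup>2 * central_factorial (Suc m) n"

lemma central_factorial_eq_0: "n < m \<Longrightarrow> central_factorial m n = 0"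
  by (induction m n rule: central_factorial.induct) auto

lemma central_factorial_diag: "central_factorial m m = 1"
  by (induction m) (auto simp: central_factorial_eq_0)

text \<open>With c = cos(x/2) one has s' = c, c' = -s/4 and c^2 = 1 - s^2/4, so the second
  derivative is again a polynomial in s.\<close>

lemma fps_deriv2_two_sin_half_power:
  "fps_deriv (fps_deriv (two_sin_half ^ (2 * Suc m))) =
     of_nat (Suc m) * (of_nat (4 * m + 2) * two_sin_half ^ (2 * m)
       - of_nat (Suc m) * two_sin_half ^ (2 * Suc m))"
proof -
  define s where "s = two_sin_half"
  define c :: "rat fps" where "c = fps_cos (1/2)"
  have s': "fps_deriv s = c"
    by (simp add: s_def c_def two_sin_half_def fps_sin_deriv numeral_fps_const mult.assoc[symmetric])
  have c': "4 * fps_deriv c = - s"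
    by (rule fps_ext) (simp add: s_def c_def two_sin_half_def fps_cos_deriv numeral_fps_const)
  have cs: "4 * c\<^sup>2 = 4 - s\<^sup>2"
    using arg_cong[OF fps_sin_cos_sum_of_squares[of "1/2 :: rat"], of "\<lambda>f. 4 * f"]
    by (simp add: s_def c_def two_sin_half_def power2_eq_square algebra_simps)
  have P: "fps_deriv (s ^ Suc k) = of_nat (Suc k) * s ^ k * c" for k
    by (simp only: fps_deriv_power' s' diff_Suc_1) (simp only: mult_ac)
  have D: "fps_deriv (s ^ (2 * Suc m)) = of_nat (2 * Suc m) * s ^ Suc (2 * m) * c"
    using P[of "Suc (2 * m)"] by simp
  have D2: "fps_deriv (fps_deriv (s ^ (2 * Suc m))) =
      of_nat (2 * Suc m) * (of_nat (Suc (2 * m)) * s ^ (2 * m) * c\<^sup>2 + s ^ Suc (2 * m) * fps_deriv c)"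
    unfolding D fps_deriv_mult P by (simp add: algebra_simps power2_eq_square)
  \<comment> \<open>Doubling makes c^2 and c' appear exactly as \<open>4 * c\<^sup>2\<close> and
    \<open>4 * fps_deriv c\<close>, ready for \<open>cs\<close> and \<open>c'\<close>.\<close>
  have "2 * fps_deriv (fps_deriv (s ^ (2 * Suc m))) =
      of_nat (Suc m) * (of_nat (Suc (2 * m)) * s ^ (2 * m) * (4 * c\<^sup>2) + s ^ Suc (2 * m) * (4 * fps_deriv c))"
    unfolding D2 by (simp add: algebra_simps)
  also have "\<dots> = 2 * (of_nat (Suc m) * (of_nat (4 * m + 2) * s ^ (2 * m)
       - of_nat (Suc m) * s ^ (2 * Suc m)))"
    unfolding cs c' by (simp add: algebra_simps power2_eq_square)
  finally show ?thesis unfolding s_def by (metis mult_left_cancel zero_neq_numeral)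
qed

text \<open>The second-derivative formula reproduces the recursion of
  \<open>central_factorial\<close>: (m+1)(4m+2)(2m)! = (2m+2)!, and the minus sign before (m+1)^2 is
  absorbed by the alternating sign.\<close>

lemma two_sin_half_power_nth:
  "fact (2 * n) * fps_nth (two_sin_half ^ (2 * m)) (2 * n) =
     (-1) ^ (m + n) * of_nat (fact (2 * m) * central_factorial m n)"
proof (induction m n rule: central_factorial.induct)
  case (4 m n)
  let ?s = two_sin_half
  have "fact (2 * Suc n) * fps_nth (?s ^ (2 * Suc m)) (2 * Suc n) =
        fact (2 * n) * fps_nth (fps_deriv (fps_deriv (?s ^ (2 * Suc m)))) (2 * n)"
    by (simp add: algebra_simps del: fps_deriv_mult power_Suc)
  also have "\<dots> = of_nat (Suc m) * (of_nat (4 * m + 2) * (fact (2 * n) * fps_nth (?s ^ (2 * m)) (2 * n))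
       - of_nat (Suc m) * (fact (2 * n) * fps_nth (?s ^ (2 * Suc m)) (2 * n)))"
    unfolding fps_deriv2_two_sin_half_power
    by (simp add: fps_of_nat[symmetric] algebra_simps del: power_Suc of_nat_Suc of_nat_add of_nat_mult mult_Suc_right)
  also have "\<dots> = (-1) ^ (Suc m + Suc n) * of_nat (fact (2 * Suc m) * central_factorial (Suc m) (Suc n))"
    unfolding 4 by (simp add: algebra_simps power2_eq_square)
  finally show ?case .
qed (auto simp: fps_nth_power_0)

lemma bernoulli_level2_even:
  "bernoulli_level2 (2 * n) =
     (\<Sum>m\<le>n. (-1) ^ (m + n) * of_nat (fact (2 * m) * central_factorial m n) / of_nat (2 * m + 1))"
proof -
  let ?f = "\<lambda>i. artanh_quot_fps $ i * (fact (2 * n) * fps_nth (two_sin_half ^ i) (2 * n))"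
  have "bernoulli_level2 (2 * n) = (\<Sum>i\<in>{0..2*n}. ?f i)"
    by (simp add: bernoulli_level2_def bernoulli_level2_fps_eq fps_compose_nth sum_distrib_left mult_ac)
  \<comment> \<open>Odd indices drop out because \<open>artanh_quot_fps\<close> is even.\<close>
  also have "\<dots> = (\<Sum>i\<in>(\<lambda>m. 2 * m) ` {..n}. ?f i)"
  proof (rule sum.mono_neutral_right)
    show "\<forall>i\<in>{0..2 * n} - (\<lambda>m. 2 * m) ` {..n}. ?f i = 0"
      by (auto simp: artanh_quot_fps_def elim!: evenE)
  qed auto
  also have "\<dots> = (\<Sum>m\<le>n. ?f (2 * m))"
    by (subst sum.reindex) (auto simp: inj_on_def)
  also have "\<dots> = (\<Sum>m\<le>n. (-1) ^ (m + n) * of_nat (fact (2 * m) * central_factorial m n) / of_nat (2 * m + 1))"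
    unfolding two_sin_half_power_nth by (simp add: artanh_quot_fps_def mult_ac)
  finally show ?thesis .
qed

section \<open>Central differences of even powers\<close>

text \<open>The 2m-th central difference of x^(2n) at x = 0; for n = 0 the convention 0^0 = 1
  applies at k = m.\<close>

definition central_diff :: "nat \<Rightarrow> nat \<Rightarrow> int" where
  "central_diff m n = (\<Sum>k\<le>2*m. (-1) ^ k * int ((2*m) choose k) * (int m - int k) ^ (2*n))"

text \<open>Put M = m+1 and x = M-k. Then x^2 = M^2 - k(2M-k), and the factor k(2M-k) is absorbed by
  the binomial coefficient, lowering 2M to 2m.\<close>

lemma central_diff_Suc_Suc:
  "central_diff (Suc m) (Suc n) =
     int ((2*m+2) * (2*m+1)) * central_diff m n + int ((Suc m)\<^sup>2) * central_diff (Suc m) n"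
proof -
  let ?M = "Suc m"
  let ?t = "\<lambda>k. (-1) ^ k * int ((2 * ?M) choose k) * (int ?M - int k) ^ (2*n)"
  let ?g = "\<lambda>k. int k * int (2 * ?M - k) * ?t k"
  \<comment> \<open>Absorption applied twice, once to each factor of k(2M-k), with k = j+1.\<close>
  have bin: "(Suc j) * (2*m+1 - j) * ((2 * ?M) choose Suc j) = (2*m+2) * (2*m+1) * ((2*m) choose j)"
    for j
  proof -
    have "Suc j * (2*m+1 - j) * ((2 * ?M) choose Suc j) =
        (2*m+1 - j) * (Suc j * (Suc (2*m+1) choose Suc j))"
      by (simp only: mult_ac) simp
    also have "\<dots> = Suc (2*m+1) * ((2*m+1 - j) * ((2*m+1) choose j))"
      unfolding Suc_times_binomial by (simp only: mult_ac)
    also have "(2*m+1 - j) * ((2*m+1) choose j) = (2*m+1) * ((2*m) choose j)"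
      using binomial_absorb_comp[of "2*m+1" j] by simp
    also have "Suc (2*m+1) * \<dots> = (2*m+2) * (2*m+1) * ((2*m) choose j)"
      by (simp only: mult.assoc add_Suc_right[symmetric] Suc_1 Suc_eq_plus1 one_add_one add.assoc)
    finally show ?thesis .
  qed
  have "central_diff ?M (Suc n) = (\<Sum>k\<le>2 * ?M. int (?M\<^sup>2) * ?t k - ?g k)"
    unfolding central_diff_def
  proof (rule sum.cong[OF refl])
    fix k assume "k \<in> {..2 * ?M}"
    hence "int (2 * ?M - k) = 2 * int ?M - int k" by auto
    thus "(-1) ^ k * int ((2 * ?M) choose k) * (int ?M - int k) ^ (2 * Suc n) =
        int (?M\<^sup>2) * ?t k - ?g k"
      by (simp add: power2_eq_square algebra_simps)
  qed
  also have "\<dots> = int (?M\<^sup>2) * central_diff ?M n - (\<Sum>k\<le>2 * ?M. ?g k)"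
    by (simp only: sum_subtractf sum_distrib_left central_diff_def)
  also have "(\<Sum>k\<le>2 * ?M. ?g k) = (\<Sum>k\<le>Suc (Suc (2 * m)). ?g k)" by simp
  \<comment> \<open>The factor k(2M-k) kills both end terms; the shift k = j+1 then flips the
    sign.\<close>
  also have "\<dots> = (\<Sum>j\<le>2*m. ?g (Suc j))"
    by (simp only: sum.atMost_Suc_shift[of _ "Suc (2*m)"] sum.atMost_Suc[of _ "2*m"]) simp
  also have "\<dots> = (\<Sum>j\<le>2*m. - (int ((2*m+2) * (2*m+1)) * 
      ((-1) ^ j * int ((2*m) choose j) * (int m - int j) ^ (2*n))))"
  proof (rule sum.cong[OF refl])
    fix j
    have e: "2 * ?M - Suc j = 2*m+1 - j" "int ?M - int (Suc j) = int m - int j" by auto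
    have "?g (Suc j) = - ((-1) ^ j * int ((Suc j) * (2*m+1 - j) * ((2 * ?M) choose Suc j)) * (int m - int j) ^ (2*n))"
      unfolding e by (simp only: of_nat_mult power_Suc mult_1_left mult_minus1 mult_minus_left mult_minus_right mult_ac)
    also have "\<dots> = - (int ((2*m+2) * (2*m+1)) * 
      ((-1) ^ j * int ((2*m) choose j) * (int m - int j) ^ (2*n)))"
      unfolding bin by (simp only: of_nat_mult mult_ac)
    finally show "?g (Suc j) = \<dots>" .
  qed
  also have "\<dots> = - (int ((2*m+2) * (2*m+1)) * central_diff m n)"
    by (simp only: sum_negf sum_distrib_left central_diff_def)
  finally show ?thesis by simp
qed

text \<open>Both sides obey the same recursion; for n = 0 < m the difference is the binomial
  expansion of (1-1)^(2m). This expresses T(2n,2m) through powers, to which Fermat's theorem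
  applies.\<close>

lemma central_diff_eq: "central_diff m n = int (fact (2 * m) * central_factorial m n)"
proof (induction m n rule: central_factorial.induct)
  case (3 m)
  have "central_diff (Suc m) 0 = (-1 + (1 :: int)) ^ (2 * Suc m)"
    unfolding binomial_ring central_diff_def by (simp add: mult_ac del: binomial_Suc_Suc)
  thus ?case by simp
next
  case (4 m n)
  show ?case
    unfolding central_diff_Suc_Suc 4 by (simp add: algebra_simps)
qed (auto simp: central_diff_def)

section \<open>Divisibility by 2m+1\<close>

text \<open>Fermat's theorem if p does not divide a; otherwise both powers are 0 modulo p, since the
  exponents are positive.\<close>

lemma cong_power_prime_period:
  fixes a :: int
  assumes p: "prime p" and ij: "0 < i" "0 < j" "[i = j] (mod (p - 1))"
  shows "[a ^ i = a ^ j] (mod int p)"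
proof -
  have "[b ^ (i + (p - 1) * k) = b ^ i] (mod int p)" if "0 < i" for i k and b :: int
  proof (cases "int p dvd b")
    case True
    hence "[b = 0] (mod int p)" by (simp add: cong_0_iff)
    hence "[b ^ x = 0 ^ x] (mod int p)" for x by (rule cong_pow)
    from this[of i] this[of "i + (p - 1) * k"] that show ?thesis
      by (metis add_gr_0 cong_sym cong_trans zero_power)
  next
    case False
    have "[b ^ (p - 1) = 1] (mod int p)"
    proof -
      define c where "c = nat (b mod int p)"
      have c: "int c = b mod int p" using prime_gt_0_nat[OF p] by (simp add: c_def)
      hence "\<not> p dvd c" using False by (metis dvd_mod_iff dvd_refl int_dvd_int_iff)
      hence "[c ^ (p - 1) = 1] (mod p)" using p by (rule fermat_theorem[rotated])
      hence "[int c ^ (p - 1) = 1] (mod int p)" by (metis cong_int_iff of_nat_1 of_nat_power)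
      moreover have "[b = int c] (mod int p)" unfolding c by (simp add: cong_def)
      ultimately show ?thesis by (meson cong_pow cong_trans)
    qed
    hence "[b ^ i * (b ^ (p - 1)) ^ k = b ^ i * 1 ^ k] (mod int p)"
      by (intro cong_mult cong_pow cong_refl)
    thus ?thesis by (simp add: power_add power_mult)
  qed
  note * = this
  \<comment> \<open>Raising both exponents to a common value avoids deciding which of them is
    larger.\<close>
  from ij(3) obtain k l where "i + (p - 1) * k = j + (p - 1) * l"
    by (metis cong_iff_lin_nat mult.commute)
  with *[OF ij(1), of a k] *[OF ij(2), of a l] show ?thesis
    by (metis cong_sym cong_trans)
qed

lemma fact_mult_central_factorial_cong:
  assumes p: "prime (2 * m + 1)" and n: "n > 0"
  shows "[int (fact (2 * m) * central_factorial m n) = (if m dvd n then -1 else 0)] (mod int (2 * m + 1))"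
proof -
  let ?p = "2 * m + 1"
  have m: "m > 0" using p by (cases m) auto
  \<comment> \<open>For m dividing n the representative is m, not 0: an exponent 0 would turn the
    term k = m from 0 into 0^0 = 1.\<close>
  define r where "r = (if m dvd n then m else n mod m)"
  have r: "r > 0" "r \<le> m" "[n = r] (mod m)"
    using m by (auto simp: r_def cong_def less_imp_le mod_greater_zero_iff_not_dvd)
  have "[2 * n = 2 * r] (mod (?p - 1))"
    using r(3) by (simp only: cong_def diff_add_inverse2 mod_mult_mult1)
  hence "[(int m - int k) ^ (2 * n) = (int m - int k) ^ (2 * r)] (mod int ?p)" for k
    using p n r by (intro cong_power_prime_period) auto
  hence "[central_diff m n = central_diff m r] (mod int ?p)"
    unfolding central_diff_def by (intro cong_sum cong_mult cong_refl)
  moreover have "[central_diff m r = (if m dvd n then -1 else 0)] (mod int ?p)"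
  proof (cases "m dvd n")
    case True
    have "[(fact (?p - 1) :: int) = -1] (mod int ?p)"
      using p m by (intro wilson_theorem) auto
    thus ?thesis using True by (simp add: r_def central_diff_eq central_factorial_diag)
  next
    case False
    thus ?thesis using m by (simp add: r_def central_diff_eq central_factorial_eq_0)
  qed
  ultimately show ?thesis unfolding central_diff_eq by (rule cong_trans)
qed

text \<open>For N = xy with 1 < x \<le> y, some multiple z of y satisfies x < z < N; then x divides
  (z-1)! and y divides z, so xy divides z!.\<close>

lemma odd_composite_dvd_fact:
  assumes "odd N" "\<not> prime N"
  shows "N dvd fact (N - 1)"
proof (cases "N = 1")
  case False
  have N: "N > 1" using False assms(1) by (cases N) auto
  then obtain a where a: "a dvd N" "a \<noteq> 1" "a \<noteq> N"
    using assms(2) by (auto simp: prime_nat_iff)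
  then obtain b where "N = a * b" by (elim dvdE)
  hence ab: "N = a * b" "1 < a" "1 < b"
    using N a by (cases a; cases b; auto)+
  have main: "x * y dvd fact (x * y - 1)" if "x \<le> y" "1 < x" "odd (x * y)" for x y :: nat
  proof -
    \<comment> \<open>Oddness excludes x = 2, and with it the exception 4, which does not divide
      3!.\<close>
    have x3: "x \<ge> 3" using that by (cases "x = 2") auto
    \<comment> \<open>If x = y, the factor y itself is not larger than x, so its double is
      taken.\<close>
    define z where "z = (if x = y then 2 * x else y)"
    have "3 * y \<le> x * y" using x3 by simp
    hence "2 * y \<le> x * y - 1" using that by linarith
    hence z: "z \<le> x * y - 1" "z > 0" "x \<le> z - 1" "y dvd z" using that by (auto simp: z_def)
    have "x dvd fact (z - 1)" using z that by (intro dvd_fact) auto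
    hence "x * y dvd fact (z - 1) * z" using z by (intro mult_dvd_mono)
    also have "fact (z - 1) * z = fact z" using z(2) by (simp add: fact_reduce)
    also have "\<dots> dvd fact (x * y - 1)" using z by (intro fact_dvd)
    finally show ?thesis .
  qed
  show ?thesis
    using main[of a b] main[of b a] ab assms(1) nat_le_linear[of a b]
    unfolding ab(1) mult.commute[of b a] by blast
qed auto

section \<open>Integrality, summand by summand\<close>

theorem theorem14:
  fixes n :: nat
  assumes "n > 0"
  shows "bernoulli_level2 (2 * n) +
    (\<Sum>p | prime p \<and> odd p \<and> (p - 1) dvd (2 * n).
        (- 1) ^ (n - (p - 1) div 2) / rat_of_nat p) \<in> \<int>"
proof -
  let ?g = "\<lambda>p. (- 1) ^ (n - (p - 1) div 2) / rat_of_nat p"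
  let ?P = "\<lambda>m. prime (2 * m + 1) \<and> m dvd n"
  let ?a = "\<lambda>m. fact (2 * m) * central_factorial m n"
  \<comment> \<open>Substitute p = 2m+1; since n > 0, m dividing n forces m \<le> n, so both sums
    can run over the same range.\<close>
  have "{p. prime p \<and> odd p \<and> (p - 1) dvd (2 * n)} = (\<lambda>m. 2 * m + 1) ` {m\<in>{..n}. ?P m}"
    using assms by (auto elim!: oddE dest: dvd_imp_le)
  hence "(\<Sum>p | prime p \<and> odd p \<and> (p - 1) dvd (2 * n). ?g p) =
      (\<Sum>m\<in>{m\<in>{..n}. ?P m}. ?g (2 * m + 1))"
    by (simp only:) (subst sum.reindex, auto simp: inj_on_def)
  also have "\<dots> = (\<Sum>m\<le>n. if ?P m then ?g (2 * m + 1) else 0)"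
    by (rule sum.inter_filter) simp
  finally have "bernoulli_level2 (2 * n) +
    (\<Sum>p | prime p \<and> odd p \<and> (p - 1) dvd (2 * n). ?g p) =
    (\<Sum>m\<le>n. (-1) ^ (m + n) * of_nat (?a m) / of_nat (2 * m + 1) + (if ?P m then ?g (2 * m + 1) else 0))"
    by (simp only: bernoulli_level2_even sum.distrib)
  also have "\<dots> \<in> \<int>"
  proof (rule Ints_sum)
    fix m assume "m \<in> {..n}"
    \<comment> \<open>As m \<le> n, the subtraction is not truncated, and n-m and m+n have equal
      parity.\<close>
    hence sign: "(-1 :: rat) ^ (n - m) = (-1) ^ (m + n)"
      by (simp add: minus_one_power_iff)
    let ?d = "if ?P m then 1 else 0 :: int"
    \<comment> \<open>With the common sign factored out, the 1 contributed by the prime sum cancels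
      the -1 from Wilson's theorem.\<close>
    have "int (2 * m + 1) dvd int (?a m) + ?d"
    proof (cases "prime (2 * m + 1)")
      case True
      thus ?thesis using fact_mult_central_factorial_cong[OF True assms]
        by (auto simp: cong_iff_dvd_diff cong_0_iff)
    next
      case False
      hence "2 * m + 1 dvd ?a m"
        using odd_composite_dvd_fact[of "2 * m + 1"] by auto
      hence "int (2 * m + 1) dvd int (?a m)" by (simp only: int_dvd_int_iff)
      thus ?thesis using False by (simp only: simp_thms if_False add_0_right)
    qed
    then obtain k where k: "int (?a m) + ?d = int (2 * m + 1) * k" by (rule dvdE)
    have "rat_of_nat (?a m) + of_int ?d = of_int (int (?a m) + ?d)" by simp
    also have "\<dots> = of_nat (2 * m + 1) * of_int k" unfolding k by simp
    finally have "(rat_of_nat (?a m) + of_int ?d) / of_nat (2 * m + 1) = of_int k"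
      by (simp add: field_simps del: of_nat_add of_nat_Suc)
    moreover have "(-1) ^ (m + n) * of_nat (?a m) / of_nat (2 * m + 1) + (if ?P m then ?g (2 * m + 1) else 0)
       = (-1) ^ (m + n) * ((rat_of_nat (?a m) + of_int ?d) / of_nat (2 * m + 1))"
      using sign by (simp add: add_divide_distrib algebra_simps)
    ultimately show "(-1) ^ (m + n) * of_nat (?a m) / of_nat (2 * m + 1)
        + (if ?P m then ?g (2 * m + 1) else 0) \<in> \<int>"
      by (simp only:) auto
  qed
  finally show ?thesis .
qed

end
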